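(* Let $T>0$ and let $f\in C([0,T])$ be a continuous positive function. Suppose that $g\in C^1((0,L])$, where $L=\max_{[0,T]}f$. (1) If $g'\le-\theta$ on $(0,L]$ for some $\theta\ge0$, then $$e^{T}\int_0^T f(x)e^{-x}\int_0^x g(f(y))e^{y}\,dy\,dx+\int_0^T f(x)e^{-x}\int_x^T g(f(y))e^{y}\,dy\,dx$$ $$\ge (e^T-1)\int_0^T f(x)g(f(x))\,dx+\frac{\theta}{2}\int_{[0,T]^2}|f(x)-f(y)|^2\,dx\,dy .$$ (2) If $g'\ge\theta$ on $(0,L]$ for some $\theta\ge0$, then $$e^{T}\int_0^T f(x)e^{-x}\int_0^x g(f(y))e^{y}\,dy\,dx+\int_0^T f(x)e^{-x}\int_x^T g(f(y))e^{y}\,dy\,dx$$ $$\le (e^T-1)\int_0^T f(x)g(f(x))\,dx-\frac{\theta}{2}\int_{[0,T]^2}|f(x)-f(y)|^2\,dx\,dy .$$ *)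

theory Defs
  imports "HOL-Analysis.Analysis"
begin

end

theory Submission
  imports Defs
begin

text \<open>
  Expanding the left-hand side as a double integral gives
  \<open>\<integral>\<integral> f x * g (f y) * K x y\<close> over the square, with the kernel
  \<open>K x y = exp (T - (x - y))\<close> for \<open>y < x\<close> and \<open>K x y = exp (y - x)\<close> for \<open>y > x\<close>.
  This kernel depends only on \<open>x - y\<close> modulo \<open>T\<close>: it equals \<open>exp (T - s)\<close>, where \<open>s\<close> in
  \<open>{0..T}\<close> is the distance from \<open>y\<close> forward to \<open>x\<close> on the circle of length \<open>T\<close>.  Hence both
  of its marginals are the constant \<open>exp T - 1\<close>, and \<open>K \<ge> 1\<close> everywhere.

  Let \<open>G\<close> be an antiderivative of \<open>g\<close>.  In the first case \<open>G\<close> is concave with modulus \<open>\<theta>\<close>,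
  so that \<open>g b * (a - b) - (G a - G b) \<ge> \<theta> / 2 * (a - b)\<^sup>2\<close>.  Take \<open>a = f x\<close> and
  \<open>b = f y\<close> and integrate against \<open>K\<close>.  The two terms with \<open>G\<close> cancel because the marginals
  agree, the term with \<open>g (f y) * f y\<close> yields \<open>exp T - 1\<close> times a single integral, and on the
  right \<open>K\<close> may be replaced by its lower bound \<open>1\<close>.  The second case is the first one for
  \<open>-g\<close>.

  The kernel enters through the operator \<open>wind\<close>, whose value at \<open>x\<close> is \<open>\<integral> p y * K x y dy\<close>.
  The marginals are \<open>wind_const\<close> and \<open>integral_wind\<close>, the lower bound is
  \<open>wind_ge_integral\<close>, and \<open>concavity_gap\<close> is the inequality for \<open>G\<close>.
\<close>

section \<open>The periodic exponential kernel\<close>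

definition wind :: "real \<Rightarrow> (real \<Rightarrow> real) \<Rightarrow> real \<Rightarrow> real" where
  "wind T p x = exp T * (exp (- x) * integral {0..x} (\<lambda>y. p y * exp y))
                + exp (- x) * integral {x..T} (\<lambda>y. p y * exp y)"

lemma exp_weight_integrable:
  fixes p :: "real \<Rightarrow> real"
  assumes "continuous_on {0..T} p" "0 \<le> a" "b \<le> T"
  shows "(\<lambda>y. p y * exp y) integrable_on {a..b}"
  by (rule integrable_continuous_interval)
     (intro continuous_intros continuous_on_subset[OF assms(1)], use assms in auto)

lemma wind_add:
  assumes "continuous_on {0..T} p" "continuous_on {0..T} q" "x \<in> {0..T}"
  shows "wind T (\<lambda>y. p y + q y) x = wind T p x + wind T q x"
  using assms unfolding wind_def
  by (simp add: distrib_right integral_add exp_weight_integrable) (simp add: algebra_simps)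

lemma wind_cmult: "wind T (\<lambda>y. c * p y) x = c * wind T p x"
  unfolding wind_def by (simp add: mult.assoc) (simp add: algebra_simps)

text \<open>Splitting the integral at \<open>x\<close> leaves a single primitive of \<open>p y * exp y\<close>, from which
  continuity in \<open>x\<close> can be read off.\<close>

lemma wind_primitive:
  assumes "continuous_on {0..T} p" "x \<in> {0..T}"
  shows "wind T p x = (exp T - 1) * (exp (- x) * integral {0..x} (\<lambda>y. p y * exp y))
           + exp (- x) * integral {0..T} (\<lambda>y. p y * exp y)"
proof -
  have "integral {0..x} (\<lambda>y. p y * exp y) + integral {x..T} (\<lambda>y. p y * exp y)
      = integral {0..T} (\<lambda>y. p y * exp y)"
    using assms by (intro Henstock_Kurzweil_Integration.integral_combine exp_weight_integrable) auto
  then have e: "integral {x..T} (\<lambda>y. p y * exp y)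
      = integral {0..T} (\<lambda>y. p y * exp y) - integral {0..x} (\<lambda>y. p y * exp y)" by linarith
  show ?thesis unfolding wind_def e by (simp add: algebra_simps)
qed

lemma continuous_on_wind:
  assumes "continuous_on {0..T} p"
  shows "continuous_on {0..T} (wind T p)"
proof -
  have "continuous_on {0..T} (\<lambda>x. integral {0..x} (\<lambda>y. p y * exp y))"
    using assms by (intro indefinite_integral_continuous_1 exp_weight_integrable) auto
  then have "continuous_on {0..T} (\<lambda>x. (exp T - 1) * (exp (- x) * integral {0..x} (\<lambda>y. p y * exp y))
           + exp (- x) * integral {0..T} (\<lambda>y. p y * exp y))"
    by (intro continuous_intros)
  then show ?thesis
    by (rule continuous_on_eq) (use assms wind_primitive in auto)
qed

lemma integral_exp_atLeastAtMost:
  fixes a b :: real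
  assumes "a \<le> b"
  shows "integral {a..b} exp = exp b - exp a"
  by (intro integral_unique fundamental_theorem_of_calculus assms)
     (auto intro!: derivative_eq_intros simp flip: has_real_derivative_iff_has_vector_derivative)

lemma wind_const:
  assumes "x \<in> {0..T}"
  shows "wind T (\<lambda>y. c) x = c * (exp T - 1)"
proof -
  have "wind T (\<lambda>y. 1) x = exp T - 1"
    using assms by (simp add: wind_def integral_exp_atLeastAtMost
        right_diff_distrib flip: exp_add)
  then show ?thesis using wind_cmult[of T c "\<lambda>y. 1" x] by simp
qed

text \<open>Integration by parts moves the integral over \<open>x\<close> past the primitive \<open>P\<close> of
  \<open>p y * exp y\<close>.  Its boundary term \<open>- (exp T - 1) * exp (- T) * P T\<close> cancels the integral
  of the remaining term \<open>exp (- x) * P T\<close> of \<open>wind_primitive\<close>; this is where the factor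
  \<open>exp T\<close> on the part below \<open>x\<close> has exactly the right size.\<close>

lemma integral_wind:
  assumes "0 \<le> T" "continuous_on {0..T} p"
  shows "integral {0..T} (wind T p) = (exp T - 1) * integral {0..T} p"
proof -
  define P where "P x = integral {0..x} (\<lambda>y. p y * exp y)" for x
  have P0: "P 0 = 0" by (simp add: P_def)
  have dP: "(P has_real_derivative p x * exp x) (at x within {0..T})" if "x \<in> {0..T}" for x
    unfolding P_def
    by (rule integral_has_real_derivative) (use assms that in \<open>auto intro!: continuous_intros\<close>)
  have ip: "p integrable_on {0..T}"
    by (rule integrable_continuous_interval) (rule assms)
  have ie: "((\<lambda>x. exp (- x) * P x - p x) has_integral - (exp (- T) * P T) - - (exp (- 0) * P 0)) {0..T}"
  proof (rule fundamental_theorem_of_calculus[OF assms(1)])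
    fix x assume x: "x \<in> {0..T}"
    have "((\<lambda>x. - (exp (- x) * P x)) has_real_derivative
        exp (- x) * P x - p x) (at x within {0..T})"
      by (rule derivative_eq_intros dP[OF x] refl)+ (simp add: exp_minus field_simps)
    then show "((\<lambda>x. - (exp (- x) * P x)) has_vector_derivative
        exp (- x) * P x - p x) (at x within {0..T})"
      by (simp add: has_real_derivative_iff_has_vector_derivative)
  qed
  have hP: "((\<lambda>x. exp (- x) * P x) has_integral integral {0..T} p - exp (- T) * P T) {0..T}"
    using has_integral_add[OF ie integrable_integral[OF ip]] by (simp add: P0)
  have he: "((\<lambda>x. exp (- x)) has_integral - exp (- T) - - exp (- 0)) {0..T}"
    by (rule fundamental_theorem_of_calculus[OF assms(1)])
       (auto intro!: derivative_eq_intros simp flip: has_real_derivative_iff_has_vector_derivative)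
  have "((\<lambda>x. (exp T - 1) * (exp (- x) * P x) + exp (- x) * P T) has_integral
      (exp T - 1) * (integral {0..T} p - exp (- T) * P T) + (- exp (- T) - - exp (- 0)) * P T) {0..T}"
    by (intro has_integral_add has_integral_mult_right has_integral_mult_left hP he)
  moreover have "(exp T - 1) * (integral {0..T} p - exp (- T) * P T) + (- exp (- T) - - exp (- 0)) * P T
      = (exp T - 1) * integral {0..T} p"
    by (simp add: exp_minus field_simps)
  ultimately have "((\<lambda>x. (exp T - 1) * (exp (- x) * P x) + exp (- x) * P T) has_integral
      (exp T - 1) * integral {0..T} p) {0..T}" by simp
  then have "(wind T p has_integral (exp T - 1) * integral {0..T} p) {0..T}"
    by (rule has_integral_eq[rotated]) (use assms wind_primitive in \<open>auto simp: P_def\<close>)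
  then show ?thesis by (rule integral_unique)
qed

text \<open>The kernel is at least \<open>1\<close>: above \<open>x\<close> because \<open>y - x \<ge> 0\<close>, and below \<open>x\<close> because
  \<open>T - (x - y) \<ge> 0\<close>.\<close>

lemma wind_ge_integral:
  assumes "continuous_on {0..T} p" "x \<in> {0..T}" "\<And>y. y \<in> {0..T} \<Longrightarrow> 0 \<le> p y"
  shows "integral {0..T} p \<le> wind T p x"
proof -
  have ip: "p integrable_on {0..T}"
    by (rule integrable_continuous_interval) (rule assms)
  have sub: "p integrable_on {a..b}" if "0 \<le> a" "b \<le> T" for a b
    by (rule integrable_on_subinterval[OF ip]) (use that in auto)
  have ie: "(\<lambda>y. p y * exp y) integrable_on {a..b}" if "0 \<le> a" "b \<le> T" for a b
    by (rule exp_weight_integrable[OF assms(1)]) (use that in auto)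
  have "integral {0..x} p \<le> integral {0..x} (\<lambda>y. exp (T - x) * (p y * exp y))"
  proof (rule integral_le)
    fix y assume y: "y \<in> {0..x}"
    have "p y * 1 \<le> p y * exp (T - x + y)"
      by (rule mult_left_mono) (use y assms in auto)
    then show "p y \<le> exp (T - x) * (p y * exp y)" by (simp add: exp_add mult_ac)
  qed (use assms sub ie in \<open>auto intro!: integrable_on_mult_right\<close>)
  moreover have "integral {x..T} p \<le> integral {x..T} (\<lambda>y. exp (- x) * (p y * exp y))"
  proof (rule integral_le)
    fix y assume y: "y \<in> {x..T}"
    have "p y * 1 \<le> p y * exp (- x + y)"
      by (rule mult_left_mono) (use y assms in auto)
    then show "p y \<le> exp (- x) * (p y * exp y)" by (simp only: exp_add mult_ac mult_1)
  qed (use assms sub ie in \<open>auto intro!: integrable_on_mult_right\<close>)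
  moreover have "integral {0..x} p + integral {x..T} p = integral {0..T} p"
    using assms ip by (intro Henstock_Kurzweil_Integration.integral_combine) auto
  moreover have "wind T p x = exp (T - x) * integral {0..x} (\<lambda>y. p y * exp y)
      + exp (- x) * integral {x..T} (\<lambda>y. p y * exp y)"
    by (simp add: wind_def exp_diff exp_minus divide_inverse)
  ultimately show ?thesis by simp
qed

section \<open>Integrating a pointwise gap against the kernel\<close>

text \<open>The theorem with the function \<open>g\<close> removed: \<open>u\<close>, \<open>v\<close>, \<open>w\<close> stand for \<open>f\<close>,
  \<open>g \<circ> f\<close>, \<open>G \<circ> f\<close>.  The terms with \<open>w\<close> disappear on integration over \<open>x\<close>, because
  \<open>w x\<close> is integrated against one marginal of the kernel and \<open>w y\<close> against the other.\<close>

lemma wind_gap_integral: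
  fixes u v w :: "real \<Rightarrow> real"
  assumes T: "0 \<le> T" and th: "0 \<le> \<theta>"
    and c: "continuous_on {0..T} u" "continuous_on {0..T} v" "continuous_on {0..T} w"
    and gap: "\<And>x y. x \<in> {0..T} \<Longrightarrow> y \<in> {0..T} \<Longrightarrow>
        \<theta> / 2 * (u x - u y)\<^sup>2 \<le> v y * (u x - u y) - (w x - w y)"
  shows "(exp T - 1) * integral {0..T} (\<lambda>x. u x * v x)
           + \<theta> / 2 * integral ({0..T} \<times> {0..T}) (\<lambda>(x, y). (u x - u y)\<^sup>2)
         \<le> integral {0..T} (\<lambda>x. u x * wind T v x)"
proof -
  let ?Q = "\<lambda>x. integral {0..T} (\<lambda>y. (u x - u y)\<^sup>2)"
  have c2: "continuous_on ({0..T} \<times> {0..T}) (\<lambda>(x, y). (u x - u y)\<^sup>2)"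
    unfolding split_beta
    by (intro continuous_intros continuous_on_compose2[OF c(1)]) auto
  have cQ: "continuous_on {0..T} ?Q"
    using integral_continuous_on_param[of "{0..T}" 0 T "\<lambda>x y. (u x - u y)\<^sup>2"] c2
    by simp
  have iQ: "integral ({0..T} \<times> {0..T}) (\<lambda>(x, y). (u x - u y)\<^sup>2) = integral {0..T} ?Q"
    using integral_prod_continuous[of 0 0 T T "\<lambda>(x, y). (u x - u y)\<^sup>2"] c2
    by (simp add: cbox_Pair_eq)
  have pw: "\<theta> / 2 * ?Q x \<le> u x * wind T v x - wind T (\<lambda>y. u y * v y) x
              - (exp T - 1) * w x + wind T w x" if x: "x \<in> {0..T}" for x
  proof -
    define H where "H y = (u x * v y + (-1) * (u y * v y)) + (- w x + w y)" for y
    have cH: "continuous_on {0..T} H"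
      unfolding H_def by (intro continuous_intros c)
    have le: "\<theta> / 2 * (u x - u y)\<^sup>2 \<le> H y" if "y \<in> {0..T}" for y
      using gap[OF x that] unfolding H_def by (simp add: algebra_simps)
    have "\<theta> / 2 * ?Q x = integral {0..T} (\<lambda>y. \<theta> / 2 * (u x - u y)\<^sup>2)" by simp
    also have "\<dots> \<le> integral {0..T} H"
      by (rule integral_le)
         (use le in \<open>auto intro!: integrable_continuous_interval continuous_intros c cH\<close>)
    also have "\<dots> \<le> wind T H x"
      by (rule wind_ge_integral[OF cH x])
         (rule order_trans[OF _ le], use th in auto)
    also have "\<dots> = wind T (\<lambda>y. u x * v y + (-1) * (u y * v y)) x + wind T (\<lambda>y. - w x + w y) x"
      unfolding H_def by (rule wind_add) (intro continuous_intros c x)+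
    also have "wind T (\<lambda>y. u x * v y + (-1) * (u y * v y)) x
        = u x * wind T v x + (-1) * wind T (\<lambda>y. u y * v y) x"
      by (subst wind_add) (simp_all only: wind_cmult x, (intro continuous_intros c)+)
    also have "wind T (\<lambda>y. - w x + w y) x = - w x * (exp T - 1) + wind T w x"
      by (subst wind_add) (simp_all only: wind_const[OF x] x c continuous_on_const)
    finally show ?thesis by (simp add: algebra_simps)
  qed
  have cuv: "continuous_on {0..T} (\<lambda>y. u y * v y)" by (intro continuous_intros c)
  have I: "p integrable_on {0..T}" if "continuous_on {0..T} p" for p :: "real \<Rightarrow> real"
    using that by (rule integrable_continuous_interval)
  have "\<theta> / 2 * integral {0..T} ?Q = integral {0..T} (\<lambda>x. \<theta> / 2 * ?Q x)" by simp
  also have "\<dots> \<le> integral {0..T} (\<lambda>x. u x * wind T v x - wind T (\<lambda>y. u y * v y) x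
              - (exp T - 1) * w x + wind T w x)"
    by (rule integral_le) (use pw in \<open>auto intro!: I continuous_intros c cQ cuv continuous_on_wind\<close>)
  also have "\<dots> = integral {0..T} (\<lambda>x. u x * wind T v x) - (exp T - 1) * integral {0..T} (\<lambda>y. u y * v y)
              - (exp T - 1) * integral {0..T} w + (exp T - 1) * integral {0..T} w"
  proof -
    have hw: "(wind T p has_integral (exp T - 1) * integral {0..T} p) {0..T}"
      if "continuous_on {0..T} p" for p
      using integrable_integral[OF I[OF continuous_on_wind[OF that]]] integral_wind[OF T that] by simp
    show ?thesis
      by (intro integral_unique has_integral_add has_integral_diff has_integral_mult_right hw cuv c
            integrable_integral I continuous_intros continuous_on_wind)
  qed
  finally show ?thesis unfolding iQ by simp
qed

section \<open>Strong concavity of the antiderivative\<close>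

text \<open>The tangent inequality for the function \<open>\<lambda>t. G t + \<theta> / 2 * t\<^sup>2\<close>, which is still concave: by
  the mean value theorem the secant slope is its derivative at a point between \<open>a\<close> and
  \<open>b\<close>, and the derivative \<open>g t + \<theta> * t\<close> is antitone.\<close>

lemma concavity_gap:
  fixes g G :: "real \<Rightarrow> real"
  assumes dG: "\<And>t. t \<in> {m..L} \<Longrightarrow> (G has_real_derivative g t) (at t within {m..L})"
    and anti: "\<And>s t. m \<le> s \<Longrightarrow> s \<le> t \<Longrightarrow> t \<le> L \<Longrightarrow> g t + \<theta> * t \<le> g s + \<theta> * s"
    and ab: "a \<in> {m..L}" "b \<in> {m..L}"
  shows "\<theta> / 2 * (a - b)\<^sup>2 \<le> g b * (a - b) - (G a - G b)"
proof -
  define \<phi> where "\<phi> t = G t + \<theta> / 2 * t\<^sup>2" for t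
  have mv: "\<exists>z\<in>{p<..<q}. \<phi> q - \<phi> p = (g z + \<theta> * z) * (q - p)"
    if "p < q" "m \<le> p" "q \<le> L" for p q
  proof -
    have "(\<phi> has_derivative (*) (g t + \<theta> * t)) (at t within {p..q})" if t: "p \<le> t" "t \<le> q" for t
    proof -
      have "(G has_real_derivative g t) (at t within {p..q})"
        by (rule DERIV_subset[OF dG]) (use t \<open>m \<le> p\<close> \<open>q \<le> L\<close> in auto)
      then have "(\<phi> has_real_derivative g t + \<theta> * t) (at t within {p..q})"
        unfolding \<phi>_def by (auto intro!: derivative_eq_intros)
      then show ?thesis by (simp add: has_field_derivative_def)
    qed
    from mvt_simple[OF \<open>p < q\<close> this] show ?thesis by auto
  qed
  have "\<phi> a - \<phi> b \<le> (g b + \<theta> * b) * (a - b)"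
  proof (cases a b rule: linorder_cases)
    case less
    then obtain z where z: "z \<in> {a<..<b}" "\<phi> b - \<phi> a = (g z + \<theta> * z) * (b - a)"
      using mv[of a b] ab by auto
    have "(g b + \<theta> * b) * (b - a) \<le> (g z + \<theta> * z) * (b - a)"
      by (rule mult_right_mono) (use anti[of z b] z ab less in auto)
    then show ?thesis using z(2) by (simp add: algebra_simps)
  next
    case greater
    then obtain z where z: "z \<in> {b<..<a}" "\<phi> a - \<phi> b = (g z + \<theta> * z) * (a - b)"
      using mv[of b a] ab by auto
    show ?thesis unfolding z(2)
      by (rule mult_right_mono) (use anti[of b z] z ab greater in auto)
  qed simp
  then show ?thesis by (simp add: \<phi>_def power2_eq_square field_simps)
qed

lemma antitone_of_deriv_le:
  fixes g g' :: "real \<Rightarrow> real"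
  assumes dg: "\<And>t. t \<in> S \<Longrightarrow> (g has_real_derivative g' t) (at t within S)"
    and le: "\<And>t. t \<in> S \<Longrightarrow> g' t \<le> - \<theta>"
    and st: "s \<le> t" "{s..t} \<subseteq> S"
  shows "g t + \<theta> * t \<le> g s + \<theta> * s"
proof (cases "s = t")
  case False
  then have "s < t" using st by simp
  have "(g has_derivative (*) (g' r)) (at r within {s..t})" if "s \<le> r" "r \<le> t" for r
    using DERIV_subset[OF dg[of r] st(2)] that st by (auto simp: has_field_derivative_def)
  from mvt_simple[OF \<open>s < t\<close> this] obtain z where z: "z \<in> {s<..<t}" "g t - g s = g' z * (t - s)"
    by auto
  have "g' z * (t - s) \<le> - \<theta> * (t - s)"
    using le[OF subsetD[OF st(2), of z]] z st by (intro mult_right_mono) auto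
  with z(2) show ?thesis by (simp add: algebra_simps)
qed simp

text \<open>Since \<open>g\<close> may be singular at \<open>0\<close>, its antiderivative starts at the minimum \<open>m\<close> of
  \<open>f\<close>, which is positive by compactness.\<close>

lemma wind_gap_of_deriv_le:
  fixes f g g' :: "real \<Rightarrow> real"
  assumes T: "0 < T" and cf: "continuous_on {0..T} f"
    and f: "\<And>x. x \<in> {0..T} \<Longrightarrow> 0 < f x" "\<And>x. x \<in> {0..T} \<Longrightarrow> f x \<le> L"
    and dg: "\<And>t. t \<in> {0<..L} \<Longrightarrow> (g has_real_derivative g' t) (at t within {0<..L})"
    and th: "0 \<le> \<theta>" and le: "\<And>t. t \<in> {0<..L} \<Longrightarrow> g' t \<le> - \<theta>"
  shows "(exp T - 1) * integral {0..T} (\<lambda>x. f x * g (f x))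
           + \<theta> / 2 * integral ({0..T} \<times> {0..T}) (\<lambda>(x, y). (f x - f y)\<^sup>2)
         \<le> integral {0..T} (\<lambda>x. f x * wind T (\<lambda>y. g (f y)) x)"
    and "continuous_on {0..T} (\<lambda>y. g (f y))"
proof -
  obtain x0 where x0: "x0 \<in> {0..T}" "\<And>x. x \<in> {0..T} \<Longrightarrow> f x0 \<le> f x"
    using continuous_attains_inf[of "{0..T}" f] cf T by auto
  define m where "m = f x0"
  have m: "0 < m" and fm: "f x \<in> {m..L}" if "x \<in> {0..T}" for x
    using that x0 f unfolding m_def by auto
  have sub: "{m..L} \<subseteq> {0<..L}" using m[OF x0(1)] by auto
  have cg: "continuous_on {m..L} g"
    by (rule continuous_on_subset[OF DERIV_continuous_on[OF dg] sub])
  show cgf: "continuous_on {0..T} (\<lambda>y. g (f y))"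
    by (rule continuous_on_compose2[OF cg cf]) (use fm in blast)
  define G where "G t = integral {m..t} g" for t
  have dG: "(G has_real_derivative g t) (at t within {m..L})" if "t \<in> {m..L}" for t
    unfolding G_def by (rule integral_has_real_derivative[OF cg that])
  have cG: "continuous_on {m..L} G" by (rule DERIV_continuous_on[OF dG])
  show "(exp T - 1) * integral {0..T} (\<lambda>x. f x * g (f x))
           + \<theta> / 2 * integral ({0..T} \<times> {0..T}) (\<lambda>(x, y). (f x - f y)\<^sup>2)
         \<le> integral {0..T} (\<lambda>x. f x * wind T (\<lambda>y. g (f y)) x)"
  proof (rule wind_gap_integral[OF _ th cf cgf])
    show "continuous_on {0..T} (\<lambda>x. G (f x))"
      by (rule continuous_on_compose2[OF cG cf]) (use fm in blast)
    show "\<theta> / 2 * (f x - f y)\<^sup>2 \<le> g (f y) * (f x - f y) - (G (f x) - G (f y))"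
      if "x \<in> {0..T}" "y \<in> {0..T}" for x y
    proof (rule concavity_gap[OF dG _ fm[OF that(1)] fm[OF that(2)]])
      show "g t + \<theta> * t \<le> g s + \<theta> * s" if "m \<le> s" "s \<le> t" "t \<le> L" for s t
        by (rule antitone_of_deriv_le[OF dg le]) (use that m[OF x0(1)] in auto)
    qed
  qed (use T in simp)
qed

section \<open>The inequality for decreasing and for increasing functions\<close>

lemma integral_mult_wind:
  assumes "continuous_on {0..T} f" "continuous_on {0..T} p"
  shows "integral {0..T} (\<lambda>x. f x * wind T p x)
       = exp T * integral {0..T} (\<lambda>x. f x * exp (- x) * integral {0..x} (\<lambda>y. p y * exp y))
         + integral {0..T} (\<lambda>x. f x * exp (- x) * integral {x..T} (\<lambda>y. p y * exp y))"
proof -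
  have i: "(\<lambda>y. p y * exp y) integrable_on {0..T}"
    by (rule exp_weight_integrable[OF assms(2)]) auto
  have "continuous_on {0..T} (\<lambda>x. integral {0..x} (\<lambda>y. p y * exp y))"
    by (rule indefinite_integral_continuous_1[OF i])
  moreover have "continuous_on {0..T} (\<lambda>x. integral {x..T} (\<lambda>y. p y * exp y))"
    by (rule indefinite_integral_continuous_1'[OF i])
  ultimately have
    "(\<lambda>x. exp T * (f x * exp (- x) * integral {0..x} (\<lambda>y. p y * exp y))) integrable_on {0..T}"
    "(\<lambda>x. f x * exp (- x) * integral {x..T} (\<lambda>y. p y * exp y)) integrable_on {0..T}"
    by (auto intro!: integrable_continuous_interval continuous_intros assms(1))
  from integral_add[OF this] show ?thesis
    by (simp add: wind_def algebra_simps)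
qed


theorem theorem2p1:
  fixes T L :: real and f g g' :: "real \<Rightarrow> real"
  assumes "T > 0"
    and "continuous_on {0..T} f"
    and "\<forall>x\<in>{0..T}. f x > 0"
    and "L \<in> f ` {0..T}" and "\<forall>x\<in>{0..T}. f x \<le> L"
    and "\<forall>t\<in>{0<..L}. (g has_real_derivative g' t) (at t within {0<..L})"
    and "continuous_on {0<..L} g'"
  shows
    "(\<forall>\<theta>\<ge>0. (\<forall>t\<in>{0<..L}. g' t \<le> - \<theta>) \<longrightarrow>
        exp T * integral {0..T} (\<lambda>x. f x * exp (- x) * integral {0..x} (\<lambda>y. g (f y) * exp y))
          + integral {0..T} (\<lambda>x. f x * exp (- x) * integral {x..T} (\<lambda>y. g (f y) * exp y))
        \<ge> (exp T - 1) * integral {0..T} (\<lambda>x. f x * g (f x))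
          + \<theta> / 2 * integral ({0..T} \<times> {0..T}) (\<lambda>(x, y). \<bar>f x - f y\<bar>\<^sup>2))
   \<and> (\<forall>\<theta>\<ge>0. (\<forall>t\<in>{0<..L}. g' t \<ge> \<theta>) \<longrightarrow>
        exp T * integral {0..T} (\<lambda>x. f x * exp (- x) * integral {0..x} (\<lambda>y. g (f y) * exp y))
          + integral {0..T} (\<lambda>x. f x * exp (- x) * integral {x..T} (\<lambda>y. g (f y) * exp y))
        \<le> (exp T - 1) * integral {0..T} (\<lambda>x. f x * g (f x))
          - \<theta> / 2 * integral ({0..T} \<times> {0..T}) (\<lambda>(x, y). \<bar>f x - f y\<bar>\<^sup>2))"
proof (intro conjI allI impI)
  fix \<theta> :: real assume th: "0 \<le> \<theta>" and le: "\<forall>t\<in>{0<..L}. g' t \<le> - \<theta>"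
  have f: "\<And>x. x \<in> {0..T} \<Longrightarrow> 0 < f x" "\<And>x. x \<in> {0..T} \<Longrightarrow> f x \<le> L"
    and dg: "\<And>t. t \<in> {0<..L} \<Longrightarrow> (g has_real_derivative g' t) (at t within {0<..L})"
    using assms by auto
  note gap = wind_gap_of_deriv_le[OF assms(1,2) f dg th bspec[OF le]]
  show "exp T * integral {0..T} (\<lambda>x. f x * exp (- x) * integral {0..x} (\<lambda>y. g (f y) * exp y))
          + integral {0..T} (\<lambda>x. f x * exp (- x) * integral {x..T} (\<lambda>y. g (f y) * exp y))
        \<ge> (exp T - 1) * integral {0..T} (\<lambda>x. f x * g (f x))
          + \<theta> / 2 * integral ({0..T} \<times> {0..T}) (\<lambda>(x, y). \<bar>f x - f y\<bar>\<^sup>2)"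
    using gap(1) integral_mult_wind[OF assms(2) gap(2)] by simp
next
  fix \<theta> :: real assume th: "0 \<le> \<theta>" and ge: "\<forall>t\<in>{0<..L}. g' t \<ge> \<theta>"
  have f: "\<And>x. x \<in> {0..T} \<Longrightarrow> 0 < f x" "\<And>x. x \<in> {0..T} \<Longrightarrow> f x \<le> L"
    and dg: "\<And>t. t \<in> {0<..L} \<Longrightarrow>
        ((\<lambda>t. - g t) has_real_derivative - g' t) (at t within {0<..L})"
    and le: "\<And>t. t \<in> {0<..L} \<Longrightarrow> - g' t \<le> - \<theta>"
    using assms ge by (auto intro!: DERIV_minus)
  note gap = wind_gap_of_deriv_le[OF assms(1,2) f dg th le]
  show "exp T * integral {0..T} (\<lambda>x. f x * exp (- x) * integral {0..x} (\<lambda>y. g (f y) * exp y))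
          + integral {0..T} (\<lambda>x. f x * exp (- x) * integral {x..T} (\<lambda>y. g (f y) * exp y))
        \<le> (exp T - 1) * integral {0..T} (\<lambda>x. f x * g (f x))
          - \<theta> / 2 * integral ({0..T} \<times> {0..T}) (\<lambda>(x, y). \<bar>f x - f y\<bar>\<^sup>2)"
    using gap(1) integral_mult_wind[OF assms(2) gap(2)] by simp
qed

end
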